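(* Let $f:\mathbb{R}^m\times\mathbb{R}^n\to\mathbb{R}^m$, let $z_{\mathrm{ss}}:\mathbb{R}^n\to\mathbb{R}^m$ satisfy $z_{\mathrm{ss}}(u)=f(z_{\mathrm{ss}}(u),u)$ for all $u\in\mathbb{R}^n$, let $\ell:\mathbb{R}^m\to\mathbb{R}$ be a cost function, and consider the closed-loop system $$u_{t+1}=u_t-\delta\gamma\nabla z_{\mathrm{ss}}(u_t)\nabla\ell(z_t),\qquad z_{t+1}=f(z_t,u_t),\qquad t\in\mathbb{N},$$ with $\gamma,\delta>0$. (i) Assume that $\ell(z_{\mathrm{ss}}(\cdot))$ is differentiable, $s$-strongly convex, and has an $L$-Lipschitz continuous gradient for some $s,L>0$. Assume that $z_{\mathrm{ss}}$ is differentiable and that there is $c_F\in(0,1)$ such that, for all $u\in\mathbb{R}^n$, the map $z\mapsto f(z,u)$ is $c_F$-contractive with respect to the distance from $z_{\mathrm{ss}}(u)$, i.e. $d(f(z,u),z_{\mathrm{ss}}(u))\le c_F\,d(z,z_{\mathrm{ss}}(u))$ for all $z\in\mathbb{R}^m$. Let $\nabla\ell$ and $z_{\mathrm{ss}}$ be $L_\ell$- and $L_{\mathrm{FIX}}$-Lipschitz continuous for some $L_\ell,L_{\mathrm{FIX}}>0$, respectively. Let $$\bar\delta:=\frac{\left(1-\sqrt{1-2\gamma sL/(s+L)}\right)(1-c_F)}{\gamma L_{\mathrm{FIX}}^2L_\ell\left(\left(1-\sqrt{1-2\gamma sL/(s+L)}\right)+\gamma L\right)}.$$ Then, for all $\gamma\in(0,2/(s+L)]$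 and $\delta\in(0,\min\{\bar\delta,1\})$, there exist $C>0$ and $\rho\in(0,1)$ such that the trajectories satisfy $$\left\|\begin{bmatrix}d(u_t,u_\star)\\ d(z_t,z_{\mathrm{ss}}(u_t))\end{bmatrix}\right\|\le C\rho^t\left\|\begin{bmatrix}d(u_0,u_\star)\\ d(z_0,z_{\mathrm{ss}}(u_0))\end{bmatrix}\right\|$$ for all $(u_0,z_0)\in\mathbb{R}^n\times\mathbb{R}^m$ and $t\in\mathbb{N}$, where $u_\star\in\mathbb{R}^n$ is the unique minimizer of $\ell(z_{\mathrm{ss}}(\cdot))$. (ii) Suppose that all the assumptions of (i) hold, except that, instead of being strongly convex, $\ell(z_{\mathrm{ss}}(\cdot))$ is only convex and satisfies the quadratic growth condition $$\ell(z_{\mathrm{ss}}(u))-\ell_\star\ge\frac s2\,d(u,U_\star)^2\qquad\text{for all }u\in\mathbb{R}^n,$$ for some $s>0$, where $U_\star$ is the set of minimizers of $\ell(z_{\mathrm{ss}}(\cdot))$ and $\ell_\star$ is its minimum value. Let $$\bar\delta:=\frac{\left(1-\sqrt{1-\frac{\gamma s^2(2-\gamma L)}{4L}}\right)(1-c_F)}{\gamma L_{\mathrm{FIX}}^2L_\ell\left(\left(1-\sqrt{1-\frac{\gamma s^2(2-\gamma L)}{4L}}\right)+\gamma L\right)}.$$ Then, for all $\gamma\in(0,2/L)$ and $\delta\in(0,\min\{\bar\delta,1\})$, there exist $C>0$ and $\rho\in(0,1)$ such that the trajectories satisfy $$\left\|\begin{bmatrix}d(u_t,U_\star)\\ d(z_t,z_{\mathrm{ss}}(u_t))\end{bmatrix}\right\|\le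 C\rho^t\left\|\begin{bmatrix}d(u_0,U_\star)\\ d(z_0,z_{\mathrm{ss}}(u_0))\end{bmatrix}\right\|$$ for all $(u_0,z_0)\in\mathbb{R}^n\times\mathbb{R}^m$ and $t\in\mathbb{N}$.
   Context: $\|\cdot\|$ and $d(\cdot,\cdot)$ are the Euclidean norm and distance; $d(u,U_\star)=\inf_{y\in U_\star}d(u,y)$. $\nabla z_{\mathrm{ss}}(u)\in\mathbb{R}^{n\times m}$ denotes the transpose of the Jacobian of $z_{\mathrm{ss}}$ at $u$, so that $\nabla z_{\mathrm{ss}}(u)\nabla\ell(z_{\mathrm{ss}}(u))$ is the gradient of $u\mapsto\ell(z_{\mathrm{ss}}(u))$. $\ell$ is differentiable. In (ii) the minimum of $\ell(z_{\mathrm{ss}}(\cdot))$ is attained (i.e. $U_\star\neq\emptyset$). The constants $C,\rho$ do not depend on the initial condition or on $t$. *)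

theory Defs
  imports "HOL-Analysis.Analysis"
begin

definition gradient :: "('a::real_inner \<Rightarrow> real) \<Rightarrow> 'a \<Rightarrow> 'a" where
  "gradient g x = (THE D. GDERIV g x :> D)"

lemma gradient_eqI:
  assumes "GDERIV g x :> D"
  shows "gradient g x = D"
proof -
  have "E = D" if "GDERIV g x :> E" for E
  proof -
    have "(\<lambda>h. h \<bullet> E) = (\<lambda>h. h \<bullet> D)"
      using assms that unfolding gderiv_def by (rule has_derivative_unique[rotated])
    then have "(E - D) \<bullet> E = (E - D) \<bullet> D" by metis
    then have "(E - D) \<bullet> (E - D) = 0" by (simp add: inner_diff_right)
    then show "E = D" by simp
  qed
  then show ?thesis
    unfolding gradient_def using assms by blast
qed

lemma gderiv_gradient:
  fixes g :: "'a::euclidean_space \<Rightarrow> real"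
  assumes "g differentiable (at x)"
  shows "GDERIV g x :> gradient g x"
proof -
  obtain g' where g': "(g has_derivative g') (at x)"
    using assms by (auto simp: differentiable_def)
  define D where "D = adjoint g' 1"
  have "g' = (\<lambda>h. h \<bullet> D)"
    using adjoint_works[OF has_derivative_linear[OF g'], of _ 1] by (auto simp: D_def)
  then have "GDERIV g x :> D"
    using g' by (simp add: gderiv_def)
  then show ?thesis using gradient_eqI by metis
qed

definition grad_map :: "(real^'n \<Rightarrow> real^'m) \<Rightarrow> real^'n \<Rightarrow> real^'m^'n" where
  "grad_map g u = transpose (jacobian g (at u))"

text \<open>With this convention the matrix of a map times the gradient of a function is the
  gradient of the composition.\<close>

lemma gradient_compose:
  fixes g :: "real^'n \<Rightarrow> real^'m" and l :: "real^'m \<Rightarrow> real"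
  assumes "g differentiable (at u)" and "l differentiable (at (g u))"
  shows "gradient (\<lambda>v. l (g v)) u = grad_map g u *v gradient l (g u)"
proof (rule gradient_eqI)
  have 1: "(g has_derivative (\<lambda>h. jacobian g (at u) *v h)) (at u)"
    using assms(1) jacobian_works by blast
  have 2: "(l has_derivative (\<lambda>h. h \<bullet> gradient l (g u))) (at (g u))"
    using gderiv_gradient[OF assms(2)] by (simp add: gderiv_def)
  have "((\<lambda>v. l (g v)) has_derivative
      (\<lambda>h. (jacobian g (at u) *v h) \<bullet> gradient l (g u))) (at u)"
    by (rule has_derivative_compose[OF 1 2])
  moreover have "(jacobian g (at u) *v h) \<bullet> gradient l (g u)
      = h \<bullet> (grad_map g u *v gradient l (g u))" for h
    by (metis dot_lmul_matrix grad_map_def inner_commute transpose_matrix_vector)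
  ultimately show "GDERIV (\<lambda>v. l (g v)) u :> grad_map g u *v gradient l (g u)"
    by (simp add: gderiv_def)
qed

definition strongly_convex_on :: "'a::real_normed_vector set \<Rightarrow> real \<Rightarrow> ('a \<Rightarrow> real) \<Rightarrow> bool" where
  "strongly_convex_on S s g \<longleftrightarrow> convex S \<and>
     (\<forall>x\<in>S. \<forall>y\<in>S. \<forall>t\<in>{0..1}.
        g ((1 - t) *\<^sub>R x + t *\<^sub>R y)
          \<le> (1 - t) * g x + t * g y - s / 2 * t * (1 - t) * (norm (x - y))\<^sup>2)"

definition minimizers :: "('a \<Rightarrow> real) \<Rightarrow> 'a set" where
  "minimizers g = {x. \<forall>y. g x \<le> g y}"

text \<open>To be used only when a minimizer exists: then the infimum is the minimum value, and
  \<^const>\<open>infdist\<close> does not take its default value for the empty set.\<close>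

definition quadratic_growth :: "real \<Rightarrow> ('a::metric_space \<Rightarrow> real) \<Rightarrow> bool" where
  "quadratic_growth s g \<longleftrightarrow>
     (\<forall>u. g u - (INF v. g v) \<ge> s / 2 * (infdist u (minimizers g))\<^sup>2)"

definition closed_loop ::
  "(real^'m \<Rightarrow> real^'n \<Rightarrow> real^'m) \<Rightarrow> (real^'n \<Rightarrow> real^'m) \<Rightarrow> (real^'m \<Rightarrow> real) \<Rightarrow> real \<Rightarrow> real
     \<Rightarrow> (nat \<Rightarrow> real^'n) \<Rightarrow> (nat \<Rightarrow> real^'m) \<Rightarrow> bool" where
  "closed_loop f zss l \<gamma> \<delta> u z \<longleftrightarrow>
     (\<forall>t. u (Suc t) = u t - (\<delta> * \<gamma>) *\<^sub>R (grad_map zss (u t) *v gradient l (z t)) \<and>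
          z (Suc t) = f (z t) (u t))"

text \<open>The argument \<open>a\<close> stands for the square root occurring in the step-size bound, which is the
  only part that differs between the strongly convex and the quadratic growth case.\<close>

definition step_bound :: "real \<Rightarrow> real \<Rightarrow> real \<Rightarrow> real \<Rightarrow> real \<Rightarrow> real \<Rightarrow> real" where
  "step_bound a \<gamma> L cF LFIX Ll =
     ((1 - a) * (1 - cF)) / (\<gamma> * LFIX\<^sup>2 * Ll * ((1 - a) + \<gamma> * L))"

end

theory Submission
  imports Defs
begin

text \<open>
  Write \<open>g u = l (zss u)\<close>, \<open>U\<close> for its set of minimizers, \<open>x\<close> for the distance of the input from
  \<open>U\<close> and \<open>y\<close> for the distance of the state from the steady state of the current input.
  The closed loop is a perturbed gradient method coupled with a contractive plant.

  If the controller saw the steady state, its update would be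
  \<open>u - \<delta> \<gamma> \<nabla>g u = (1 - \<delta>) u + \<delta> (u - \<gamma> \<nabla>g u)\<close>, a convex combination (here \<open>\<delta> < 1\<close> enters) of
  the current point and a full gradient step. The full step shrinks the distance to the closest
  minimizer by the factor \<open>a\<close> that is the square root in the step-size bound
  (\<open>gradient_step_contraction_strongly_convex\<close>, \<open>gradient_step_contraction_quadratic_growth\<close>);
  both factors come from one cocoercivity inequality, \<open>quadratic_bounds_imp_cocoercive\<close>.
  Using the measured state instead costs at most \<open>\<delta> \<gamma> LFIX Ll y\<close>, because the transposed
  Jacobian of \<open>zss\<close> is bounded by the Lipschitz constant of \<open>zss\<close>. Conversely the plant
  contracts \<open>y\<close> by \<open>cF\<close>, but the moving input shifts the steady state by at most \<open>LFIX\<close> times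
  the length of the input update, which is at most \<open>\<delta> \<gamma> (L x + LFIX Ll y)\<close>. Hence one step of
  the loop obeys
    \<open>x' \<le> (1 - \<delta> (1 - a)) x + \<delta> \<gamma> LFIX Ll y\<close>,
    \<open>y' \<le> \<delta> \<gamma> LFIX L x + (cF + \<delta> \<gamma> LFIX\<^sup>2 Ll) y\<close>.
  Let \<open>M\<close> be the matrix of this system. The requirement \<open>\<delta> < step_bound a \<gamma> L cF LFIX Ll\<close> is
  exactly the inequality \<open>det (I - M) > 0\<close>, and a weighted sum of \<open>x\<close> and \<open>y\<close> then decays
  geometrically (\<open>coupled_linear_decay\<close>).
\<close>

section \<open>First-order inequalities for smooth and strongly convex functions\<close>

lemma gderiv_along_line:
  fixes g :: "'a::euclidean_space \<Rightarrow> real"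
  assumes "g differentiable (at (x + t *\<^sub>R d))"
  shows "((\<lambda>t. g (x + t *\<^sub>R d)) has_real_derivative gradient g (x + t *\<^sub>R d) \<bullet> d) (at t)"
proof -
  have g: "(g has_derivative (\<lambda>h. h \<bullet> gradient g (x + t *\<^sub>R d))) (at (x + t *\<^sub>R d))"
    using gderiv_gradient[OF assms] by (simp add: gderiv_def)
  have "((\<lambda>t. x + t *\<^sub>R d) has_derivative (\<lambda>h. h *\<^sub>R d)) (at t)"
    by (auto intro!: derivative_eq_intros)
  from has_derivative_compose[OF this g] show ?thesis
    by (simp add: has_field_derivative_def inner_commute mult.commute[of _ "_ \<bullet> _"])
qed

text \<open>Divide the defining inequality at \<open>x + t (y - x)\<close> by \<open>t\<close> and let \<open>t\<close> tend to \<open>0\<close> from the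
  right. The parameter \<open>s\<close> may be \<open>0\<close>, which is the case of plain convexity.\<close>

lemma strongly_convex_on_lower_bound:
  fixes g :: "'a::euclidean_space \<Rightarrow> real"
  assumes conv: "strongly_convex_on UNIV s g" and diff: "g differentiable (at x)"
  shows "g x + gradient g x \<bullet> (y - x) + s / 2 * (norm (y - x))\<^sup>2 \<le> g y"
proof -
  define d where "d = y - x"
  have lim: "((\<lambda>t. (g (x + t *\<^sub>R d) - g x) / t) \<longlongrightarrow> gradient g x \<bullet> d) (at_right 0)"
  proof -
    have "((\<lambda>t. g (x + t *\<^sub>R d)) has_real_derivative gradient g x \<bullet> d) (at 0)"
      using gderiv_along_line[of g x 0 d] diff by simp
    then have "((\<lambda>t. g (x + t *\<^sub>R d)) has_real_derivative gradient g x \<bullet> d) (at_right 0)"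
      by (rule has_field_derivative_at_within)
    then show ?thesis
      by (simp add: has_field_derivative_iff)
  qed
  have lim': "((\<lambda>t. g y - g x - s / 2 * (1 - t) * (norm d)\<^sup>2)
      \<longlongrightarrow> g y - g x - s / 2 * (1 - 0) * (norm d)\<^sup>2) (at_right 0)"
    by (intro tendsto_intros)
  have "eventually (\<lambda>t. (g (x + t *\<^sub>R d) - g x) / t \<le> g y - g x - s / 2 * (1 - t) * (norm d)\<^sup>2)
      (at_right (0::real))"
    unfolding eventually_at_right_field
  proof (intro exI[of _ 1] conjI allI impI)
    fix t :: real assume t: "0 < t" "t < 1"
    have "g ((1 - t) *\<^sub>R x + t *\<^sub>R y)
        \<le> (1 - t) * g x + t * g y - s / 2 * t * (1 - t) * (norm (x - y))\<^sup>2"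
      using conv t by (auto simp: strongly_convex_on_def)
    moreover have "(1 - t) *\<^sub>R x + t *\<^sub>R y = x + t *\<^sub>R d"
      by (simp add: d_def algebra_simps)
    ultimately have "g (x + t *\<^sub>R d) - g x \<le> (g y - g x - s / 2 * (1 - t) * (norm d)\<^sup>2) * t"
      by (simp add: d_def norm_minus_commute algebra_simps)
    then show "(g (x + t *\<^sub>R d) - g x) / t \<le> g y - g x - s / 2 * (1 - t) * (norm d)\<^sup>2"
      using t by (simp add: divide_le_eq)
  qed simp
  from tendsto_le[OF _ lim' lim this] show ?thesis
    by (simp add: d_def)
qed

lemma convex_on_imp_strongly_convex_on_0:
  "convex_on S g \<Longrightarrow> strongly_convex_on S 0 g"
  by (auto simp: convex_on_def strongly_convex_on_def)

text \<open>The descent lemma: along the segment from \<open>x\<close> to \<open>y\<close> the left side minus the right side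
  has derivative at most \<open>0\<close>, by Cauchy-Schwarz and the Lipschitz bound.\<close>

lemma lipschitz_gradient_upper_bound:
  fixes g :: "'a::euclidean_space \<Rightarrow> real"
  assumes diff: "\<And>x. g differentiable (at x)" and lip: "L-lipschitz_on UNIV (gradient g)"
  shows "g y \<le> g x + gradient g x \<bullet> (y - x) + L / 2 * (norm (y - x))\<^sup>2"
proof -
  define d where "d = y - x"
  define \<phi> where "\<phi> t = g (x + t *\<^sub>R d) - t * (gradient g x \<bullet> d) - L / 2 * t\<^sup>2 * (norm d)\<^sup>2" for t
  have "\<exists>D. (\<phi> has_real_derivative D) (at t) \<and> D \<le> 0" if t: "0 \<le> t" for t
  proof (intro exI conjI)
    have "((\<lambda>t. t * (gradient g x \<bullet> d) + L / 2 * t\<^sup>2 * (norm d)\<^sup>2) has_real_derivative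
        gradient g x \<bullet> d + L * t * (norm d)\<^sup>2) (at t)"
      by (auto intro!: derivative_eq_intros)
    from DERIV_diff[OF gderiv_along_line[of g x t d, OF diff] this] show "(\<phi> has_real_derivative
        gradient g (x + t *\<^sub>R d) \<bullet> d - gradient g x \<bullet> d - L * t * (norm d)\<^sup>2) (at t)"
      unfolding \<phi>_def[abs_def] by (simp add: diff_diff_eq)
    have "norm (gradient g (x + t *\<^sub>R d) - gradient g x) \<le> L * norm (x + t *\<^sub>R d - x)"
      using lipschitz_on_normD[OF lip] by blast
    then have *: "norm (gradient g (x + t *\<^sub>R d) - gradient g x) \<le> L * t * norm d"
      using t by simp
    have "(gradient g (x + t *\<^sub>R d) - gradient g x) \<bullet> d
        \<le> norm (gradient g (x + t *\<^sub>R d) - gradient g x) * norm d"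
      by (rule norm_cauchy_schwarz)
    also have "\<dots> \<le> L * t * norm d * norm d"
      using * by (rule mult_right_mono) simp
    finally show "gradient g (x + t *\<^sub>R d) \<bullet> d - gradient g x \<bullet> d - L * t * (norm d)\<^sup>2 \<le> 0"
      by (simp add: inner_diff_left power2_eq_square algebra_simps)
  qed
  then have "\<phi> 1 \<le> \<phi> 0"
    by (intro DERIV_nonpos_imp_nonincreasing[of 0 1]) simp_all
  then show ?thesis
    by (simp add: \<phi>_def d_def)
qed

text \<open>For \<open>s = 0\<close> this is the Baillon-Haddad cocoercivity of the gradient, and for \<open>s > 0\<close> its
  strongly convex sharpening. The reason: the parabola above \<open>g\<close> at one point
  must lie over the parabola below \<open>g\<close> at the other point. Comparing them at \<open>x - w\<close> and at \<open>y + w\<close>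
  and adding cancels the values of \<open>g\<close>; the inequality is then the best choice of \<open>w\<close>, a multiple
  of \<open>G x - G y - s (x - y)\<close>.\<close>

lemma quadratic_bounds_imp_cocoercive:
  fixes g :: "'a::euclidean_space \<Rightarrow> real" and G :: "'a \<Rightarrow> 'a"
  assumes lower: "\<And>x y. g x + G x \<bullet> (y - x) + s / 2 * (norm (y - x))\<^sup>2 \<le> g y"
    and upper: "\<And>x y. g y \<le> g x + G x \<bullet> (y - x) + L / 2 * (norm (y - x))\<^sup>2"
  shows "s * L * (norm (x - y))\<^sup>2 + (norm (G x - G y))\<^sup>2 \<le> (s + L) * ((G x - G y) \<bullet> (x - y))"
proof -
  define d E where "d = x - y" and "E = G x - G y"
  define H K where "H = E - s *\<^sub>R d" and "K = E \<bullet> d - s * (norm d)\<^sup>2"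
  have "s \<le> L"
  proof -
    obtain b :: 'a where "norm b = 1"
      using vector_choose_size zero_le_one by blast
    then show ?thesis
      using lower[of 0 b] upper[of b 0] by simp
  qed
  have key: "(2 * \<tau> - (L - s) * \<tau>\<^sup>2) * (norm H)\<^sup>2 \<le> K" for \<tau>
  proof -
    define w where "w = \<tau> *\<^sub>R H"
    have "g y + G y \<bullet> (d - w) + s / 2 * (norm (d - w))\<^sup>2 \<le> g (x - w)"
      using lower[of y "x - w"] by (simp add: d_def algebra_simps)
    also have "\<dots> \<le> g x - G x \<bullet> w + L / 2 * (norm w)\<^sup>2"
      using upper[of "x - w" x] by simp
    finally have 1: "g y + G y \<bullet> (d - w) + s / 2 * (norm (d - w))\<^sup>2
      \<le> g x - G x \<bullet> w + L / 2 * (norm w)\<^sup>2" .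
    have "g x + G x \<bullet> (w - d) + s / 2 * (norm (w - d))\<^sup>2 \<le> g (y + w)"
      using lower[of x "y + w"] by (simp add: d_def algebra_simps)
    also have "\<dots> \<le> g y + G y \<bullet> w + L / 2 * (norm w)\<^sup>2"
      using upper[of "y + w" y] by simp
    finally have 2: "g x + G x \<bullet> (w - d) + s / 2 * (norm (w - d))\<^sup>2
      \<le> g y + G y \<bullet> w + L / 2 * (norm w)\<^sup>2" .
    have "2 * (E \<bullet> w) - E \<bullet> d + s * (norm (d - w))\<^sup>2 \<le> L * (norm w)\<^sup>2"
      using 1 2 by (simp add: E_def inner_diff_left inner_diff_right norm_minus_commute)
    then have "2 * (H \<bullet> w) - (L - s) * (norm w)\<^sup>2 \<le> K"
      by (simp add: H_def K_def power2_norm_eq_inner inner_diff_left inner_diff_right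
          inner_commute algebra_simps)
    moreover have "H \<bullet> w = \<tau> * (norm H)\<^sup>2" "(norm w)\<^sup>2 = \<tau>\<^sup>2 * (norm H)\<^sup>2"
      by (simp_all add: w_def power2_norm_eq_inner power_mult_distrib)
    ultimately show ?thesis
      by (simp add: algebra_simps)
  qed
  have "(norm H)\<^sup>2 \<le> (L - s) * K"
  proof (cases "s = L")
    case True
    \<comment> \<open>The bound is now linear in the step, so an arbitrarily long step rules out a nonzero
      direction.\<close>
    have "norm H = 0"
    proof (rule ccontr)
      assume "norm H \<noteq> 0"
      with key[of "(K + 1) / (2 * (norm H)\<^sup>2)"] True show False
        by simp
    qed
    with True show ?thesis by simp
  next
    case False
    with \<open>s \<le> L\<close> have sL: "0 < L - s" by simp
    \<comment> \<open>The step \<open>1 / (L - s)\<close> maximizes the left side of the bound.\<close>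
    have "2 * (1 / (L - s)) - (L - s) * (1 / (L - s))\<^sup>2 = 1 / (L - s)"
      using sL by (simp add: power2_eq_square)
    with key[of "1 / (L - s)"] have "1 / (L - s) * (norm H)\<^sup>2 \<le> K" by simp
    with sL show ?thesis by (simp add: field_simps)
  qed
  then have "s * L * (norm d)\<^sup>2 + (norm E)\<^sup>2 \<le> (s + L) * (E \<bullet> d)"
    by (simp add: H_def K_def power2_norm_eq_inner inner_diff_left inner_diff_right
        inner_commute algebra_simps)
  then show ?thesis
    by (simp add: d_def E_def)
qed

section \<open>Minimizers\<close>

lemma gradient_minimizer:
  fixes g :: "'a::euclidean_space \<Rightarrow> real"
  assumes diff: "g differentiable (at p)" and "p \<in> minimizers g"
  shows "gradient g p = 0"
proof -
  have "(\<lambda>h. h \<bullet> gradient g p) = (\<lambda>h. 0)"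
    using assms(2) gderiv_gradient[OF diff]
    by (intro differential_zero_maxmin[of p UNIV g "\<lambda>h. h \<bullet> gradient g p"])
      (simp_all add: minimizers_def gderiv_def)
  from fun_cong[OF this, of "gradient g p"] show ?thesis
    by simp
qed

text \<open>The quadratic lower bound at \<open>0\<close> shows that values outside a ball of a suitable radius are
  at least \<open>g 0\<close>, so that a minimum over the compact ball is a global one. The same lower bound at
  a minimizer, where the gradient vanishes, gives uniqueness.\<close>

lemma strongly_convex_minimizers_singleton:
  fixes g :: "'a::euclidean_space \<Rightarrow> real"
  assumes conv: "strongly_convex_on UNIV s g" and diff: "\<And>x. g differentiable (at x)" and "s > 0"
  shows "\<exists>p. minimizers g = {p}"
proof -
  \<comment> \<open>Beyond this radius the quadratic term outweighs the linear one.\<close>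
  define R where "R = 2 * norm (gradient g 0) / s"
  have "R \<ge> 0" using \<open>s > 0\<close> by (simp add: R_def)
  have "continuous_on (cball 0 R) g"
    using diff by (simp add: continuous_at_imp_continuous_on differentiable_imp_continuous_within)
  then obtain p where p: "\<And>y. y \<in> cball 0 R \<Longrightarrow> g p \<le> g y"
    using continuous_attains_inf[of "cball 0 R" g] \<open>R \<ge> 0\<close> by (metis cball_eq_empty compact_cball not_less)
  have far: "g 0 \<le> g y" if "y \<notin> cball 0 R" for y
  proof -
    have "g 0 + gradient g 0 \<bullet> y + s / 2 * (norm y)\<^sup>2 \<le> g y"
      using strongly_convex_on_lower_bound[OF conv diff, of 0 y] by simp
    moreover have "- (gradient g 0 \<bullet> y) \<le> norm (gradient g 0) * norm y"
      using norm_cauchy_schwarz[of "- gradient g 0" y] by simp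
    moreover have "norm (gradient g 0) * norm y \<le> (s / 2 * norm y) * norm y"
      using that \<open>s > 0\<close> by (intro mult_right_mono) (auto simp: R_def field_simps)
    ultimately show ?thesis
      by (simp add: power2_eq_square)
  qed
  have "g p \<le> g 0" using p \<open>R \<ge> 0\<close> by simp
  then have "g p \<le> g y" for y
    using p[of y] far[of y] by (cases "y \<in> cball 0 R") auto
  then have pmin: "p \<in> minimizers g" by (simp add: minimizers_def)
  have "q = p" if "q \<in> minimizers g" for q
  proof -
    have "g p + s / 2 * (norm (q - p))\<^sup>2 \<le> g q"
      using strongly_convex_on_lower_bound[OF conv diff, of p q] gradient_minimizer[OF diff pmin] by simp
    moreover have "g q \<le> g p" using that by (simp add: minimizers_def)
    ultimately have "s * (norm (q - p))\<^sup>2 \<le> 0" by simp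
    with \<open>s > 0\<close> show ?thesis by (simp add: mult_le_0_iff)
  qed
  with pmin show ?thesis by blast
qed

lemma closest_minimizer_exists:
  fixes g :: "'a::euclidean_space \<Rightarrow> real"
  assumes diff: "\<And>x. g differentiable (at x)" and "minimizers g \<noteq> {}"
  obtains p where "p \<in> minimizers g" and "infdist u (minimizers g) = dist u p"
proof -
  have "continuous_on UNIV g"
    using diff by (simp add: continuous_at_imp_continuous_on differentiable_imp_continuous_within)
  then have "closed {x. \<forall>y. g x \<le> g y}"
    by (intro closed_Collect_all closed_Collect_le continuous_on_const)
  then have "closed (minimizers g)" by (simp add: minimizers_def)
  from infdist_attains_inf[OF this assms(2), of u] that show ?thesis by blast
qed

section \<open>One gradient step brings an iterate closer to the minimizers\<close>

lemma norm_diff_scaleR_power2: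
  fixes d v :: "'a::real_inner"
  shows "(norm (d - c *\<^sub>R v))\<^sup>2 = (norm d)\<^sup>2 - 2 * c * (v \<bullet> d) + c\<^sup>2 * (norm v)\<^sup>2"
  unfolding power2_norm_eq_inner
  by (simp add: inner_diff_left inner_diff_right inner_commute power2_eq_square algebra_simps)

text \<open>Expand the square of the new distance and bound its cross term by cocoercivity between \<open>u\<close>
  and \<open>p\<close>; what remains of the squared gradient has the coefficient \<open>\<gamma>\<^sup>2 - 2 \<gamma> / (s + L)\<close>, which is
  nonpositive for the step sizes considered.\<close>

lemma gradient_step_contraction_strongly_convex:
  fixes g :: "'a::euclidean_space \<Rightarrow> real"
  assumes conv: "strongly_convex_on UNIV s g" and diff: "\<And>x. g differentiable (at x)"
    and lip: "L-lipschitz_on UNIV (gradient g)" and pos: "0 < s" "0 < L"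
    and p: "p \<in> minimizers g" and \<gamma>: "0 < \<gamma>" "\<gamma> \<le> 2 / (s + L)"
  shows "dist (u - \<gamma> *\<^sub>R gradient g u) p \<le> sqrt (1 - 2 * \<gamma> * s * L / (s + L)) * dist u p"
proof -
  define d G where "d = u - p" and "G = gradient g u"
  have "s * L * (norm d)\<^sup>2 + (norm G)\<^sup>2 \<le> (s + L) * (G \<bullet> d)"
    using quadratic_bounds_imp_cocoercive[of g "gradient g" s L u p]
      strongly_convex_on_lower_bound[OF conv diff] lipschitz_gradient_upper_bound[OF diff lip]
      gradient_minimizer[OF diff p]
    by (simp add: d_def G_def)
  then have coco: "(s * L * (norm d)\<^sup>2 + (norm G)\<^sup>2) / (s + L) \<le> G \<bullet> d"
    using pos by (simp add: divide_le_eq mult.commute)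
  have "\<gamma>\<^sup>2 * (norm G)\<^sup>2 \<le> \<gamma> * (2 / (s + L)) * (norm G)\<^sup>2"
    using \<gamma> by (intro mult_right_mono) (simp_all add: power2_eq_square del: times_divide_eq_right)
  moreover have "2 * \<gamma> * ((s * L * (norm d)\<^sup>2 + (norm G)\<^sup>2) / (s + L)) \<le> 2 * \<gamma> * (G \<bullet> d)"
    using coco \<gamma> by (intro mult_left_mono) auto
  moreover have "(norm (d - \<gamma> *\<^sub>R G))\<^sup>2 = (norm d)\<^sup>2 - 2 * \<gamma> * (G \<bullet> d) + \<gamma>\<^sup>2 * (norm G)\<^sup>2"
    by (rule norm_diff_scaleR_power2)
  ultimately have "(norm (d - \<gamma> *\<^sub>R G))\<^sup>2 \<le> (1 - 2 * \<gamma> * s * L / (s + L)) * (norm d)\<^sup>2"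
    by (simp add: add_divide_distrib algebra_simps)
  then have "norm (d - \<gamma> *\<^sub>R G) \<le> sqrt ((1 - 2 * \<gamma> * s * L / (s + L)) * (norm d)\<^sup>2)"
    by (rule real_le_rsqrt)
  then show ?thesis
    by (simp add: d_def G_def dist_norm real_sqrt_mult diff_diff_eq add.commute[of p])
qed

text \<open>Here cocoercivity (with \<open>s = 0\<close>) only says that the squared distance drops by at least
  \<open>\<gamma> (2 - \<gamma> L) / L\<close> times the squared gradient. Quadratic growth together with convexity makes the
  gradient large away from the minimizers: \<open>s / 2 * dist u p\<close> is a lower bound for its norm.

  The radicand is negative only if \<open>s\<close> exceeds \<open>2 * L\<close>, in which case the bound on the
  squares forces \<open>u = p\<close>; the statement therefore also covers a constant \<open>g\<close>, which has
  quadratic growth for every \<open>s\<close>.\<close>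

lemma gradient_step_contraction_quadratic_growth:
  fixes g :: "'a::euclidean_space \<Rightarrow> real"
  assumes conv: "convex_on UNIV g" and diff: "\<And>x. g differentiable (at x)"
    and lip: "L-lipschitz_on UNIV (gradient g)" and pos: "0 < s" "0 < L"
    and growth: "quadratic_growth s g"
    and p: "p \<in> minimizers g" "infdist u (minimizers g) = dist u p"
    and \<gamma>: "0 < \<gamma>" "\<gamma> < 2 / L"
  shows "dist (u - \<gamma> *\<^sub>R gradient g u) p
    \<le> sqrt (1 - \<gamma> * s\<^sup>2 * (2 - \<gamma> * L) / (4 * L)) * dist u p"
proof -
  define d G where "d = u - p" and "G = gradient g u"
  have lower: "g x + gradient g x \<bullet> (y - x) + 0 / 2 * (norm (y - x))\<^sup>2 \<le> g y" for x y
    by (rule strongly_convex_on_lower_bound[OF convex_on_imp_strongly_convex_on_0[OF conv] diff])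
  have "(norm G)\<^sup>2 \<le> L * (G \<bullet> d)"
    using quadratic_bounds_imp_cocoercive[of g "gradient g" 0 L u p]
      lower lipschitz_gradient_upper_bound[OF diff lip] gradient_minimizer[OF diff p(1)]
    by (simp add: d_def G_def)
  then have coco: "(norm G)\<^sup>2 / L \<le> G \<bullet> d"
    using pos by (simp add: divide_le_eq mult.commute)
  have "(INF v. g v) = g p"
    using p(1) by (intro cInf_eq_minimum) (auto simp: minimizers_def)
  with growth p(2) have "s / 2 * (norm d)\<^sup>2 \<le> g u - g p"
    unfolding quadratic_growth_def d_def dist_norm by metis
  also have "\<dots> \<le> G \<bullet> d"
    using lower[of u p] by (simp add: d_def G_def inner_diff_right)
  also have "\<dots> \<le> norm G * norm d"
    by (rule norm_cauchy_schwarz)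
  finally have "s / 2 * norm d \<le> norm G"
    by (cases "norm d = 0") (auto simp: power2_eq_square)
  then have "(s / 2 * norm d)\<^sup>2 \<le> (norm G)\<^sup>2"
    using pos by (intro power_mono) auto
  moreover have c: "0 \<le> \<gamma> * (2 - \<gamma> * L) / L"
    using \<gamma> pos by (simp add: field_simps)
  ultimately have "\<gamma> * (2 - \<gamma> * L) / L * (s / 2 * norm d)\<^sup>2 \<le> \<gamma> * (2 - \<gamma> * L) / L * (norm G)\<^sup>2"
    by (intro mult_left_mono)
  moreover have "2 * \<gamma> * ((norm G)\<^sup>2 / L) \<le> 2 * \<gamma> * (G \<bullet> d)"
    using coco \<gamma> by (intro mult_left_mono) auto
  moreover have "(norm (d - \<gamma> *\<^sub>R G))\<^sup>2 = (norm d)\<^sup>2 - 2 * \<gamma> * (G \<bullet> d) + \<gamma>\<^sup>2 * (norm G)\<^sup>2"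
    by (rule norm_diff_scaleR_power2)
  moreover have "\<gamma> * (2 - \<gamma> * L) / L * (norm G)\<^sup>2 = 2 * \<gamma> * ((norm G)\<^sup>2 / L) - \<gamma>\<^sup>2 * (norm G)\<^sup>2"
    using pos by (simp add: field_simps power2_eq_square)
  moreover have "\<gamma> * (2 - \<gamma> * L) / L * (s / 2 * norm d)\<^sup>2
      = \<gamma> * s\<^sup>2 * (2 - \<gamma> * L) / (4 * L) * (norm d)\<^sup>2"
    using pos by (simp add: field_simps power2_eq_square)
  ultimately have "(norm (d - \<gamma> *\<^sub>R G))\<^sup>2 \<le> (1 - \<gamma> * s\<^sup>2 * (2 - \<gamma> * L) / (4 * L)) * (norm d)\<^sup>2"
    by (simp add: left_diff_distrib)
  then have "norm (d - \<gamma> *\<^sub>R G) \<le> sqrt ((1 - \<gamma> * s\<^sup>2 * (2 - \<gamma> * L) / (4 * L)) * (norm d)\<^sup>2)"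
    by (rule real_le_rsqrt)
  then show ?thesis
    by (simp add: d_def G_def dist_norm real_sqrt_mult diff_diff_eq add.commute[of p])
qed

section \<open>The interconnection\<close>

lemma lipschitz_derivative_norm_le:
  fixes h :: "'a::real_normed_vector \<Rightarrow> 'b::real_normed_vector"
  assumes h: "(h has_derivative h') (at x)" and lip: "K-lipschitz_on UNIV h"
  shows "norm (h' v) \<le> K * norm v"
proof -
  interpret h': bounded_linear h' by (rule has_derivative_bounded_linear[OF h])
  have "((\<lambda>t. x + t *\<^sub>R v) has_derivative (\<lambda>t. t *\<^sub>R v)) (at (0::real))"
    by (auto intro!: derivative_eq_intros)
  then have "((\<lambda>t. h (x + t *\<^sub>R v)) has_derivative (\<lambda>t. h' (t *\<^sub>R v))) (at (0::real))"
    by (rule has_derivative_compose) (use h in simp)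
  then have "((\<lambda>t. h (x + t *\<^sub>R v)) has_vector_derivative h' v) (at 0)"
    by (simp add: has_vector_derivative_def h'.scaleR)
  then have lim: "((\<lambda>t. norm (h (x + t *\<^sub>R v) - h x - t *\<^sub>R h' v) / \<bar>t\<bar>) \<longlongrightarrow> 0) (at 0)"
    by (simp add: has_vector_derivative_def has_derivative_at)
  have "norm (h' v) \<le> K * norm v + norm (h (x + t *\<^sub>R v) - h x - t *\<^sub>R h' v) / \<bar>t\<bar>"
    if "t \<noteq> 0" for t :: real
  proof -
    have "norm (h (x + t *\<^sub>R v) - h x) \<le> K * (\<bar>t\<bar> * norm v)"
      using lipschitz_on_normD[OF lip, of "x + t *\<^sub>R v" x] by simp
    then have "\<bar>t\<bar> * norm (h' v)
        \<le> \<bar>t\<bar> * (K * norm v) + norm (h (x + t *\<^sub>R v) - h x - t *\<^sub>R h' v)"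
      using norm_triangle_ineq2[of "t *\<^sub>R h' v" "h (x + t *\<^sub>R v) - h x"]
      by (simp add: norm_minus_commute mult_ac)
    with that show ?thesis by (simp add: field_simps)
  qed
  then have "eventually (\<lambda>t. norm (h' v)
      \<le> K * norm v + norm (h (x + t *\<^sub>R v) - h x - t *\<^sub>R h' v) / \<bar>t\<bar>) (at 0)"
    by (simp add: eventually_at_filter)
  from tendsto_lowerbound[OF tendsto_add[OF tendsto_const lim] this] show ?thesis by simp
qed

text \<open>A matrix and its transpose have the same operator norm; with \<open>J\<close> the Jacobian and
  \<open>v\<close> the vector to be bounded, \<open>v \<bullet> v = (J v) \<bullet> w\<close>.\<close>

lemma norm_grad_map_mult_le:
  fixes h :: "real^'n \<Rightarrow> real^'m"
  assumes "h differentiable (at u)" and lip: "K-lipschitz_on UNIV h"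
  shows "norm (grad_map h u *v w) \<le> K * norm w"
proof -
  define J where "J = jacobian h (at u)"
  define v where "v = grad_map h u *v w"
  have "(h has_derivative (\<lambda>v. J *v v)) (at u)"
    using assms(1) jacobian_works unfolding J_def by blast
  then have "norm (J *v v) \<le> K * norm v"
    by (rule lipschitz_derivative_norm_le[OF _ lip])
  then have "norm (J *v v) * norm w \<le> K * norm v * norm w"
    by (rule mult_right_mono) simp
  moreover have "v \<bullet> v = (J *v v) \<bullet> w"
    by (metis J_def v_def dot_lmul_matrix grad_map_def inner_commute transpose_matrix_vector)
  moreover have "(J *v v) \<bullet> w \<le> norm (J *v v) * norm w"
    by (rule norm_cauchy_schwarz)
  ultimately have "norm v * norm v \<le> norm v * (K * norm w)"
    by (simp add: power2_norm_eq_inner[symmetric] power2_eq_square mult_ac)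
  moreover have "0 \<le> K * norm w"
    using lipschitz_on_nonneg[OF lip] by simp
  ultimately show ?thesis
    unfolding v_def[symmetric] by (cases "norm v = 0") auto
qed

lemma norm_vector_2_bounds:
  fixes x y :: real
  shows "\<bar>x\<bar> \<le> norm (vector [x, y] :: real^2)" and "\<bar>y\<bar> \<le> norm (vector [x, y] :: real^2)"
    and "norm (vector [x, y] :: real^2) \<le> \<bar>x\<bar> + \<bar>y\<bar>"
proof -
  show "\<bar>x\<bar> \<le> norm (vector [x, y] :: real^2)" "\<bar>y\<bar> \<le> norm (vector [x, y] :: real^2)"
    using component_le_norm_cart[of "vector [x, y] :: real^2" 1]
      component_le_norm_cart[of "vector [x, y] :: real^2" 2] by (simp_all only: vector_2)
  show "norm (vector [x, y] :: real^2) \<le> \<bar>x\<bar> + \<bar>y\<bar>"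
    using norm_le_l1_cart[of "vector [x, y] :: real^2"] by (simp only: sum_2 vector_2)
qed

text \<open>The comparison matrix \<open>M\<close> has the rows \<open>(1 - A, B)\<close> and \<open>(D, 1 - E)\<close>, and \<open>B D < A E\<close> says
  \<open>det (I - M) > 0\<close>. The decaying quantity is \<open>p x + y\<close> for a weight \<open>p\<close> strictly between \<open>D / A\<close>
  and \<open>E / B\<close>: these two bounds on \<open>p\<close> say that both columns of \<open>M\<close> shrink under the weights
  \<open>(p, 1)\<close>. The constants depend on the matrix alone, uniformly in the sequences.\<close>

lemma coupled_linear_decay:
  fixes A B D E :: real
  assumes pos: "0 < A" "0 < B" "0 < D" "0 < E" and small_gain: "B * D < A * E"
  shows "\<exists>C>0. \<exists>\<rho>. 0 < \<rho> \<and> \<rho> < 1 \<and>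
    (\<forall>x y. (\<forall>t. 0 \<le> x t \<and> 0 \<le> y t \<and> x (Suc t) \<le> (1 - A) * x t + B * y t \<and>
              y (Suc t) \<le> D * x t + (1 - E) * y t) \<longrightarrow>
      (\<forall>t. norm (vector [x t, y t] :: real^2) \<le> C * \<rho> ^ t * norm (vector [x 0, y 0] :: real^2)))"
proof -
  have "D / A < E / B"
    using pos small_gain by (simp add: field_simps)
  then obtain p where p: "D / A < p" "p < E / B"
    using dense by blast
  have "0 < p" using p pos by (meson divide_pos_pos less_trans)
  have Ap: "D < p * A" and Bp: "p * B < E"
    using p pos by (simp_all add: field_simps)
  \<comment> \<open>The diagonal entries may be negative; the value \<open>1 / 2\<close> keeps the rate positive.\<close>
  define \<rho> where "\<rho> = Max {(p * (1 - A) + D) / p, p * B + (1 - E), 1 / 2}"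
  have \<rho>: "0 < \<rho>" "\<rho> < 1" "p * (1 - A) + D \<le> \<rho> * p" "p * B + (1 - E) \<le> \<rho>"
  proof -
    show "\<rho> < 1"
      using Ap Bp \<open>0 < p\<close> by (auto simp: \<rho>_def field_simps)
    have "1 / 2 \<le> \<rho>" unfolding \<rho>_def by (rule Max_ge) auto
    then show "0 < \<rho>" by linarith
    have "(p * (1 - A) + D) / p \<le> \<rho>" by (simp add: \<rho>_def)
    then show "p * (1 - A) + D \<le> \<rho> * p" using \<open>0 < p\<close> by (simp add: divide_le_eq)
    show "p * B + (1 - E) \<le> \<rho>" by (simp add: \<rho>_def)
  qed
  define C where "C = (1 / p + 1) * (p + 1)"
  have "0 < C" using \<open>0 < p\<close> by (simp add: C_def add_pos_pos)
  show ?thesis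
  proof (rule exI[of _ C], rule conjI[OF \<open>0 < C\<close>], rule exI[of _ \<rho>], intro conjI allI impI \<rho>(1,2))
    fix x y :: "nat \<Rightarrow> real" and t
    assume *: "\<forall>t. 0 \<le> x t \<and> 0 \<le> y t \<and> x (Suc t) \<le> (1 - A) * x t + B * y t \<and>
              y (Suc t) \<le> D * x t + (1 - E) * y t"
    define V where "V t = p * x t + y t" for t
    have V_step: "V (Suc t) \<le> \<rho> * V t" for t
    proof -
      have "V (Suc t) \<le> p * ((1 - A) * x t + B * y t) + (D * x t + (1 - E) * y t)"
        unfolding V_def using * \<open>0 < p\<close> by (intro add_mono mult_left_mono) auto
      also have "\<dots> = (p * (1 - A) + D) * x t + (p * B + (1 - E)) * y t"
        by (simp add: algebra_simps)
      also have "\<dots> \<le> \<rho> * p * x t + \<rho> * y t"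
        using * \<rho> by (intro add_mono mult_right_mono) auto
      finally show ?thesis by (simp add: V_def algebra_simps)
    qed
    have V: "V t \<le> \<rho> ^ t * V 0"
    proof (induction t)
      case (Suc t)
      have "V (Suc t) \<le> \<rho> * V t" by (rule V_step)
      also have "\<dots> \<le> \<rho> * (\<rho> ^ t * V 0)"
        using Suc \<rho> by (intro mult_left_mono) auto
      finally show ?case by simp
    qed simp
    let ?N = "norm (vector [x 0, y 0] :: real^2)"
    have "V 0 \<le> p * ?N + ?N"
      unfolding V_def using norm_vector_2_bounds(1,2)[where x = "x 0" and y = "y 0"] * \<open>0 < p\<close>
      by (intro add_mono mult_left_mono) (auto simp: abs_le_iff)
    then have V0: "V 0 \<le> (p + 1) * ?N" by (simp add: algebra_simps)
    have "norm (vector [x t, y t] :: real^2) \<le> x t + y t"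
      using norm_vector_2_bounds(3)[of "x t" "y t"] * by simp
    also have "\<dots> \<le> (1 / p + 1) * V t"
      using * \<open>0 < p\<close> by (simp add: V_def algebra_simps)
    also have "\<dots> \<le> (1 / p + 1) * (\<rho> ^ t * V 0)"
      using V \<open>0 < p\<close> by (intro mult_left_mono) auto
    also have "\<dots> \<le> (1 / p + 1) * (\<rho> ^ t * ((p + 1) * ?N))"
      using V0 \<open>0 < p\<close> \<rho> by (intro mult_left_mono) auto
    finally show "norm (vector [x t, y t] :: real^2) \<le> C * \<rho> ^ t * ?N"
      by (simp add: C_def mult_ac)
  qed
qed

text \<open>Both convergence claims are instances of this lemma, which sees the shape of the cost only
  through the Lipschitz constant of its gradient and the contraction factor \<open>a\<close> of a full gradient
  step towards some closest point \<open>p\<close> of \<open>U\<close>. Measuring both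
  the current point and the full gradient step from the same \<open>p\<close> is what makes the
  convex combination estimate work.\<close>

lemma closed_loop_linear_decay:
  fixes f :: "real^'m \<Rightarrow> real^'n \<Rightarrow> real^'m"
    and zss :: "real^'n \<Rightarrow> real^'m"
    and l :: "real^'m \<Rightarrow> real"
    and U :: "(real^'n) set"
    and L cF Ll LFIX a \<gamma> \<delta> :: real
  assumes l_diff: "\<And>z. l differentiable (at z)"
    and pos: "0 < L" "0 < Ll" "0 < LFIX"
    and cost_grad_lipschitz: "L-lipschitz_on UNIV (gradient (\<lambda>v. l (zss v)))"
    and zss_diff: "\<And>u. zss differentiable (at u)"
    and cF: "cF < 1"
    and contractive: "\<And>u z. dist (f z u) (zss u) \<le> cF * dist z (zss u)"
    and l_grad_lipschitz: "Ll-lipschitz_on UNIV (gradient l)"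
    and zss_lipschitz: "LFIX-lipschitz_on UNIV zss"
    and stationary: "\<And>p. p \<in> U \<Longrightarrow> gradient (\<lambda>v. l (zss v)) p = 0"
    and gradient_step: "\<And>u. \<exists>p\<in>U. infdist u U = dist u p \<and>
          dist (u - \<gamma> *\<^sub>R gradient (\<lambda>v. l (zss v)) u) p \<le> a * dist u p"
    and a: "a < 1" and \<gamma>: "0 < \<gamma>" and \<delta>: "0 < \<delta>" "\<delta> < min (step_bound a \<gamma> L cF LFIX Ll) 1"
  shows "\<exists>C>0. \<exists>\<rho>. 0 < \<rho> \<and> \<rho> < 1 \<and>
    (\<forall>u z. closed_loop f zss l \<gamma> \<delta> u z \<longrightarrow>
      (\<forall>t. norm (vector [infdist (u t) U, dist (z t) (zss (u t))] :: real^2)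
        \<le> C * \<rho> ^ t * norm (vector [infdist (u 0) U, dist (z 0) (zss (u 0))] :: real^2)))"
proof -
  define A B D E where "A = \<delta> * (1 - a)" and "B = \<delta> * \<gamma> * LFIX * Ll"
    and "D = \<delta> * \<gamma> * LFIX * L" and "E = 1 - cF - \<delta> * \<gamma> * LFIX\<^sup>2 * Ll"
  have ABD: "0 < A" "0 < B" "0 < D"
    using a \<gamma> \<delta> pos by (auto simp: A_def B_def D_def)
  have "0 < \<gamma> * LFIX\<^sup>2 * Ll * ((1 - a) + \<gamma> * L)"
    using a \<gamma> pos by (intro mult_pos_pos add_pos_pos) auto
  with \<delta> have step: "\<delta> * (\<gamma> * LFIX\<^sup>2 * Ll * ((1 - a) + \<gamma> * L)) < (1 - a) * (1 - cF)"
    by (simp add: step_bound_def less_divide_eq)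
  then have "\<delta> * (\<delta> * (\<gamma> * LFIX\<^sup>2 * Ll * ((1 - a) + \<gamma> * L))) < \<delta> * ((1 - a) * (1 - cF))"
    using \<delta> by (intro mult_strict_left_mono) auto
  then have small_gain: "B * D < A * E"
    by (simp add: A_def B_def D_def E_def algebra_simps power2_eq_square)
  have "0 < A * E"
    using small_gain mult_pos_pos[OF ABD(2,3)] by linarith
  with ABD have E: "0 < E" by (simp add: zero_less_mult_iff)
  \<comment> \<open>The comparison system for the two distances; \<open>e\<close> is the error made by evaluating the gradient
    of \<open>l\<close> at the measured state.\<close>
  have loop: "infdist (u (Suc t)) U \<le> (1 - A) * infdist (u t) U + B * dist (z t) (zss (u t)) \<and>
      dist (z (Suc t)) (zss (u (Suc t))) \<le> D * infdist (u t) U + (1 - E) * dist (z t) (zss (u t))"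
    if cl: "closed_loop f zss l \<gamma> \<delta> u z" for u z t
  proof -
    define y where "y = dist (z t) (zss (u t))"
    define G where "G = gradient (\<lambda>v. l (zss v)) (u t)"
    define e where "e = grad_map zss (u t) *v (gradient l (z t) - gradient l (zss (u t)))"
    obtain p where p: "p \<in> U" "infdist (u t) U = dist (u t) p"
      and step: "dist (u t - \<gamma> *\<^sub>R G) p \<le> a * dist (u t) p"
      using gradient_step[of "u t"] unfolding G_def by blast
    have "G = grad_map zss (u t) *v gradient l (zss (u t))"
      unfolding G_def by (rule gradient_compose[OF zss_diff l_diff])
    then have u_Suc: "u (Suc t) = u t - (\<delta> * \<gamma>) *\<^sub>R G - (\<delta> * \<gamma>) *\<^sub>R e"
      and z_Suc: "z (Suc t) = f (z t) (u t)"
      using cl by (simp_all add: closed_loop_def e_def matrix_vector_mult_diff_distrib algebra_simps)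
    have "norm e \<le> LFIX * norm (gradient l (z t) - gradient l (zss (u t)))"
      unfolding e_def by (rule norm_grad_map_mult_le[OF zss_diff zss_lipschitz])
    also have "\<dots> \<le> LFIX * (Ll * y)"
      using lipschitz_onD[OF l_grad_lipschitz, of "z t" "zss (u t)"] pos
      by (intro mult_left_mono) (auto simp: y_def dist_norm)
    finally have e: "norm e \<le> LFIX * Ll * y" by simp
    have G: "norm G \<le> L * dist (u t) p"
      using lipschitz_onD[OF cost_grad_lipschitz, of "u t" p] stationary[OF p(1)]
      by (simp add: G_def)
    have "infdist (u (Suc t)) U \<le> dist (u (Suc t)) p"
      using p(1) by (rule infdist_le)
    also have "\<dots> = norm ((1 - \<delta>) *\<^sub>R (u t - p) + \<delta> *\<^sub>R (u t - \<gamma> *\<^sub>R G - p) - (\<delta> * \<gamma>) *\<^sub>R e)"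
      by (simp add: u_Suc dist_norm algebra_simps)
    also have "\<dots> \<le> (1 - \<delta>) * dist (u t) p + \<delta> * dist (u t - \<gamma> *\<^sub>R G) p + \<delta> * \<gamma> * norm e"
      using \<delta> \<gamma> norm_triangle_ineq4[of "(1 - \<delta>) *\<^sub>R (u t - p) + \<delta> *\<^sub>R (u t - \<gamma> *\<^sub>R G - p)" "(\<delta> * \<gamma>) *\<^sub>R e"]
        norm_triangle_ineq[of "(1 - \<delta>) *\<^sub>R (u t - p)" "\<delta> *\<^sub>R (u t - \<gamma> *\<^sub>R G - p)"]
      by (simp add: dist_norm)
    also have "\<dots> \<le> (1 - \<delta>) * dist (u t) p + \<delta> * (a * dist (u t) p) + \<delta> * \<gamma> * (LFIX * Ll * y)"
      using \<delta> \<gamma> step e by (intro add_mono mult_left_mono) auto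
    also have "\<dots> = (1 - A) * infdist (u t) U + B * y"
      by (simp add: A_def B_def p(2) algebra_simps)
    finally have 1: "infdist (u (Suc t)) U \<le> (1 - A) * infdist (u t) U + B * y" .
    have "dist (u t) (u (Suc t)) = \<delta> * \<gamma> * norm (G + e)"
      using \<delta> \<gamma> by (simp add: u_Suc dist_norm flip: scaleR_add_right)
    also have "\<dots> \<le> \<delta> * \<gamma> * (L * dist (u t) p + LFIX * Ll * y)"
      using \<delta> \<gamma> G e by (intro mult_left_mono norm_triangle_le add_mono) auto
    finally have du: "dist (u t) (u (Suc t)) \<le> \<delta> * \<gamma> * (L * dist (u t) p + LFIX * Ll * y)" .
    have "dist (z (Suc t)) (zss (u (Suc t)))
        \<le> dist (f (z t) (u t)) (zss (u t)) + dist (zss (u t)) (zss (u (Suc t)))"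
      unfolding z_Suc by (rule dist_triangle)
    also have "\<dots> \<le> cF * y + LFIX * dist (u t) (u (Suc t))"
      using contractive lipschitz_onD[OF zss_lipschitz] unfolding y_def by (intro add_mono) auto
    also have "\<dots> \<le> cF * y + LFIX * (\<delta> * \<gamma> * (L * dist (u t) p + LFIX * Ll * y))"
      using du pos by (intro add_left_mono mult_left_mono) auto
    also have "\<dots> = D * infdist (u t) U + (1 - E) * y"
      by (simp add: D_def E_def p(2) algebra_simps power2_eq_square)
    finally have 2: "dist (z (Suc t)) (zss (u (Suc t))) \<le> D * infdist (u t) U + (1 - E) * y" .
    show ?thesis using 1 2 by (simp add: y_def)
  qed
  obtain C \<rho> where "0 < C" "0 < \<rho>" "\<rho> < 1"
    and decay: "\<And>x y t. (\<forall>t. 0 \<le> x t \<and> 0 \<le> y t \<and> x (Suc t) \<le> (1 - A) * x t + B * y t \<and>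
              y (Suc t) \<le> D * x t + (1 - E) * y t) \<Longrightarrow>
      norm (vector [x t, y t] :: real^2) \<le> C * \<rho> ^ t * norm (vector [x 0, y 0] :: real^2)"
    using coupled_linear_decay[OF ABD E small_gain] by blast
  show ?thesis
  proof (rule exI[of _ C], rule conjI[OF \<open>0 < C\<close>], rule exI[of _ \<rho>], intro conjI allI impI)
    fix u z t assume cl: "closed_loop f zss l \<gamma> \<delta> u z"
    show "norm (vector [infdist (u t) U, dist (z t) (zss (u t))] :: real^2)
        \<le> C * \<rho> ^ t * norm (vector [infdist (u 0) U, dist (z 0) (zss (u 0))] :: real^2)"
      by (rule decay[of "\<lambda>t. infdist (u t) U" "\<lambda>t. dist (z t) (zss (u t))"])
        (use loop[OF cl] in \<open>simp add: infdist_nonneg\<close>)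
  qed fact+
qed

section \<open>Linear convergence of the closed loop\<close>

theorem proposition1:
  fixes f :: "real^'m \<Rightarrow> real^'n \<Rightarrow> real^'m"
    and zss :: "real^'n \<Rightarrow> real^'m"
    and l :: "real^'m \<Rightarrow> real"
    and s L cF Ll LFIX :: real
  assumes fixpoint: "\<And>u. zss u = f (zss u) u"
    and l_diff: "\<And>z. l differentiable (at z)"
    and pos: "s > 0" "L > 0" "Ll > 0" "LFIX > 0"
    and cost_diff: "\<And>u. (\<lambda>v. l (zss v)) differentiable (at u)"
    and cost_grad_lipschitz: "L-lipschitz_on UNIV (gradient (\<lambda>v. l (zss v)))"
    and zss_diff: "\<And>u. zss differentiable (at u)"
    and cF: "0 < cF" "cF < 1"
    and contractive: "\<And>u z. dist (f z u) (zss u) \<le> cF * dist z (zss u)"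
    and l_grad_lipschitz: "Ll-lipschitz_on UNIV (gradient l)"
    and zss_lipschitz: "LFIX-lipschitz_on UNIV zss"
  shows
    "(strongly_convex_on UNIV s (\<lambda>v. l (zss v)) \<longrightarrow>
      (\<exists>ustar. minimizers (\<lambda>v. l (zss v)) = {ustar} \<and>
        (\<forall>\<gamma> \<delta>. 0 < \<gamma> \<and> \<gamma> \<le> 2 / (s + L) \<and> 0 < \<delta> \<and>
            \<delta> < min (step_bound (sqrt (1 - 2 * \<gamma> * s * L / (s + L))) \<gamma> L cF LFIX Ll) 1 \<longrightarrow>
          (\<exists>C>0. \<exists>\<rho>. 0 < \<rho> \<and> \<rho> < 1 \<and>
            (\<forall>u z. closed_loop f zss l \<gamma> \<delta> u z \<longrightarrow>
              (\<forall>t. norm (vector [dist (u t) ustar, dist (z t) (zss (u t))] :: real^2)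
                \<le> C * \<rho> ^ t *
                  norm (vector [dist (u 0) ustar, dist (z 0) (zss (u 0))] :: real^2)))))))
     \<and>
     (convex_on UNIV (\<lambda>v. l (zss v)) \<and> minimizers (\<lambda>v. l (zss v)) \<noteq> {} \<and>
        quadratic_growth s (\<lambda>v. l (zss v)) \<longrightarrow>
        (\<forall>\<gamma> \<delta>. 0 < \<gamma> \<and> \<gamma> < 2 / L \<and> 0 < \<delta> \<and>
            \<delta> < min (step_bound (sqrt (1 - \<gamma> * s\<^sup>2 * (2 - \<gamma> * L) / (4 * L))) \<gamma> L cF LFIX Ll) 1 \<longrightarrow>
          (\<exists>C>0. \<exists>\<rho>. 0 < \<rho> \<and> \<rho> < 1 \<and>
            (\<forall>u z. closed_loop f zss l \<gamma> \<delta> u z \<longrightarrow>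
              (\<forall>t. norm (vector [infdist (u t) (minimizers (\<lambda>v. l (zss v))),
                                  dist (z t) (zss (u t))] :: real^2)
                \<le> C * \<rho> ^ t *
                  norm (vector [infdist (u 0) (minimizers (\<lambda>v. l (zss v))),
                                dist (z 0) (zss (u 0))] :: real^2))))))"
proof (intro conjI impI)
  let ?g = "\<lambda>v. l (zss v)"
  note decay = closed_loop_linear_decay[OF l_diff pos(2,3,4) cost_grad_lipschitz zss_diff cF(2)
      contractive l_grad_lipschitz zss_lipschitz]
  assume sc: "strongly_convex_on UNIV s ?g"
  obtain ustar where ustar: "minimizers ?g = {ustar}"
    using strongly_convex_minimizers_singleton[OF sc cost_diff pos(1)] by blast
  then have min: "ustar \<in> minimizers ?g" by simp
  show "\<exists>ustar. minimizers ?g = {ustar} \<and>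
        (\<forall>\<gamma> \<delta>. 0 < \<gamma> \<and> \<gamma> \<le> 2 / (s + L) \<and> 0 < \<delta> \<and>
            \<delta> < min (step_bound (sqrt (1 - 2 * \<gamma> * s * L / (s + L))) \<gamma> L cF LFIX Ll) 1 \<longrightarrow>
          (\<exists>C>0. \<exists>\<rho>. 0 < \<rho> \<and> \<rho> < 1 \<and>
            (\<forall>u z. closed_loop f zss l \<gamma> \<delta> u z \<longrightarrow>
              (\<forall>t. norm (vector [dist (u t) ustar, dist (z t) (zss (u t))] :: real^2)
                \<le> C * \<rho> ^ t *
                  norm (vector [dist (u 0) ustar, dist (z 0) (zss (u 0))] :: real^2)))))"
  proof (intro exI[of _ ustar] conjI ustar allI impI, elim conjE)
    fix \<gamma> \<delta> :: real
    let ?a = "sqrt (1 - 2 * \<gamma> * s * L / (s + L))"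
    assume \<gamma>: "0 < \<gamma>" "\<gamma> \<le> 2 / (s + L)"
      and \<delta>: "0 < \<delta>" "\<delta> < min (step_bound ?a \<gamma> L cF LFIX Ll) 1"
    have "?a < 1"
      using \<gamma> pos by simp
    then show "\<exists>C>0. \<exists>\<rho>. 0 < \<rho> \<and> \<rho> < 1 \<and>
            (\<forall>u z. closed_loop f zss l \<gamma> \<delta> u z \<longrightarrow>
              (\<forall>t. norm (vector [dist (u t) ustar, dist (z t) (zss (u t))] :: real^2)
                \<le> C * \<rho> ^ t *
                  norm (vector [dist (u 0) ustar, dist (z 0) (zss (u 0))] :: real^2)))"
      using decay[of "{ustar}" \<gamma> ?a \<delta>] \<gamma>(1) \<delta> gradient_minimizer[OF cost_diff min]
        gradient_step_contraction_strongly_convex[OF sc cost_diff cost_grad_lipschitz pos(1,2) min \<gamma>]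
      by simp
  qed
next
  let ?g = "\<lambda>v. l (zss v)"
  let ?U = "minimizers ?g"
  note decay = closed_loop_linear_decay[OF l_diff pos(2,3,4) cost_grad_lipschitz zss_diff cF(2)
      contractive l_grad_lipschitz zss_lipschitz]
  assume "convex_on UNIV ?g \<and> ?U \<noteq> {} \<and> quadratic_growth s ?g"
  then have conv: "convex_on UNIV ?g" and ne: "?U \<noteq> {}" and growth: "quadratic_growth s ?g"
    by auto
  show "\<forall>\<gamma> \<delta>. 0 < \<gamma> \<and> \<gamma> < 2 / L \<and> 0 < \<delta> \<and>
            \<delta> < min (step_bound (sqrt (1 - \<gamma> * s\<^sup>2 * (2 - \<gamma> * L) / (4 * L))) \<gamma> L cF LFIX Ll) 1 \<longrightarrow>
          (\<exists>C>0. \<exists>\<rho>. 0 < \<rho> \<and> \<rho> < 1 \<and>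
            (\<forall>u z. closed_loop f zss l \<gamma> \<delta> u z \<longrightarrow>
              (\<forall>t. norm (vector [infdist (u t) ?U, dist (z t) (zss (u t))] :: real^2)
                \<le> C * \<rho> ^ t *
                  norm (vector [infdist (u 0) ?U, dist (z 0) (zss (u 0))] :: real^2))))"
  proof (intro allI impI, elim conjE)
    fix \<gamma> \<delta> :: real
    let ?a = "sqrt (1 - \<gamma> * s\<^sup>2 * (2 - \<gamma> * L) / (4 * L))"
    assume \<gamma>: "0 < \<gamma>" "\<gamma> < 2 / L"
      and \<delta>: "0 < \<delta>" "\<delta> < min (step_bound ?a \<gamma> L cF LFIX Ll) 1"
    have "\<gamma> * L < 2" using \<gamma> pos by (simp add: less_divide_eq)
    then have a: "?a < 1"
      using \<gamma> pos by simp
    show "\<exists>C>0. \<exists>\<rho>. 0 < \<rho> \<and> \<rho> < 1 \<and>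
            (\<forall>u z. closed_loop f zss l \<gamma> \<delta> u z \<longrightarrow>
              (\<forall>t. norm (vector [infdist (u t) ?U, dist (z t) (zss (u t))] :: real^2)
                \<le> C * \<rho> ^ t *
                  norm (vector [infdist (u 0) ?U, dist (z 0) (zss (u 0))] :: real^2)))"
    proof (rule decay[OF gradient_minimizer[OF cost_diff] _ a \<gamma>(1) \<delta>])
      fix u
      obtain p where p: "p \<in> ?U" "infdist u ?U = dist u p"
        using closest_minimizer_exists[OF cost_diff ne] by blast
      show "\<exists>p\<in>?U. infdist u ?U = dist u p \<and> dist (u - \<gamma> *\<^sub>R gradient ?g u) p \<le> ?a * dist u p"
        using gradient_step_contraction_quadratic_growth[OF conv cost_diff cost_grad_lipschitz
            pos(1,2) growth p \<gamma>] p by blast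
    qed
  qed
qed

end
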